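(* Consider the dynamics $\dot x=f(t,x)$ with $f:\mathbb{R}_{\ge0}\times\mathbb{R}^n\to\mathbb{R}^n$ continuously differentiable in $x$ and continuous in $t$. Let $C\subseteq\mathbb{R}^n$ be open, convex, and forward invariant, and let $\|\cdot\|$ be a norm on $\mathbb{R}^n$ with compatible weak pairing $[\![\cdot,\cdot]\!]$ satisfying Deimling's inequality. Then, for $b\in\mathbb{R}$, the following statements are equivalent: (i) $\operatorname{osL}(f(t,\cdot))\le b$ on $C$ with respect to $[\![\cdot,\cdot]\!]$, for all $t\ge0$; (ii) $[\![Df(t,x)v,v]\!]\le b\|v\|^2$ for all $v\in\mathbb{R}^n$, $x\in C$, $t\ge0$; (iii) $\mu(Df(t,x))\le b$ for all $x\in C$, $t\ge0$; (iv) $D^+\|\phi(t,t_0,x_0)-\phi(t,t_0,y_0)\|\le b\|\phi(t,t_0,x_0)-\phi(t,t_0,y_0)\|$ for all $x_0,y_0\in C$ and $0\le t_0\le t$ for which the solutions exist; (v) $\|\phi(t,t_0,x_0)-\phi(t,t_0,y_0)\|\le e^{b(t-s)}\|\phi(s,t_0,x_0)-\phi(s,t_0,y_0)\|$ for all $x_0,y_0\in C$ and $0\le t_0\le s\le t$ for which the solutions exist.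
   Context: A weak pairing on $\mathbb{R}^n$ is a map $[\![\cdot,\cdot]\!]:\mathbb{R}^n\times\mathbb{R}^n\to\mathbb{R}$ such that: (1) $[\![x_1+x_2,y]\!]\le[\![x_1,y]\!]+[\![x_2,y]\!]$ for all $x_1,x_2,y$, and it is continuous in its first argument; (2) $[\![\alpha x,y]\!]=[\![x,\alpha y]\!]=\alpha[\![x,y]\!]$ for all $x,y$ and all $\alpha\ge 0$, and $[\![-x,-y]\!]=[\![x,y]\!]$; (3) $[\![x,x]\!]>0$ for all $x\ne 0_n$; (4) $|[\![x,y]\!]|\le[\![x,x]\!]^{1/2}[\![y,y]\!]^{1/2}$ for all $x,y$. It is compatible with the norm $\|\cdot\|$ if $[\![x,x]\!]=\|x\|^2$ for all $x$. It satisfies Deimling's inequality if $[\![x,y]\!]\le\|y\|\lim_{h\to0^+}\frac{\|y+hx\|-\|y\|}{h}$ for all $x,y\in\mathbb{R}^n$. For a map $g:C\to\mathbb{R}^n$, $\operatorname{osL}(g)=\sup_{x\ne y,\ x,y\in C}\frac{[\![g(x)-g(y),x-y]\!]}{\|x-y\|^2}\in\mathbb{R}\cup\{\infty\}$. $\phi(t,t_0,x_0)$ is the solution of $\dot x=f(t,x)$ at time $t$ with $x(t_0)=x_0$. $Df(t,x)=\partial f/\partial x(t,x)$. $\mu(A)=\lim_{h\to0^+}\frac{\|I_n+hA\|-1}{h}$ (induced matrix norm) is the logarithmic norm. $D^+\varphi(t)=\limsup_{h\to0^+}\frac{\varphi(t+h)-\varphi(t)}{h}$ is the upper right Dini derivative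 (with respect to $t$). *)

theory Defs
  imports "HOL-Analysis.Analysis"
begin

definition is_norm :: "(real ^ 'n \<Rightarrow> real) \<Rightarrow> bool" where
  "is_norm N \<longleftrightarrow>
     (\<forall>x. 0 \<le> N x) \<and>
     (\<forall>x. N x = 0 \<longleftrightarrow> x = 0) \<and>
     (\<forall>c x. N (c *\<^sub>R x) = \<bar>c\<bar> * N x) \<and>
     (\<forall>x y. N (x + y) \<le> N x + N y)"

definition weak_pairing :: "(real ^ 'n \<Rightarrow> real ^ 'n \<Rightarrow> real) \<Rightarrow> bool" where
  "weak_pairing W \<longleftrightarrow>
     (\<forall>x1 x2 y. W (x1 + x2) y \<le> W x1 y + W x2 y) \<and>
     (\<forall>y. continuous_on UNIV (\<lambda>x. W x y)) \<and>
     (\<forall>\<alpha>\<ge>0. \<forall>x y. W (\<alpha> *\<^sub>R x) y = \<alpha> * W x y \<and> W x (\<alpha> *\<^sub>R y) = \<alpha> * W x y) \<and>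
     (\<forall>x y. W (- x) (- y) = W x y) \<and>
     (\<forall>x. x \<noteq> 0 \<longrightarrow> 0 < W x x) \<and>
     (\<forall>x y. \<bar>W x y\<bar> \<le> sqrt (W x x) * sqrt (W y y))"

definition compatible_pairing ::
    "(real ^ 'n \<Rightarrow> real) \<Rightarrow> (real ^ 'n \<Rightarrow> real ^ 'n \<Rightarrow> real) \<Rightarrow> bool" where
  "compatible_pairing N W \<longleftrightarrow> (\<forall>x. W x x = (N x)\<^sup>2)"

(* For a norm N the limit always exists, by convexity of h \<mapsto> N (y + h x). *)
definition deimling ::
    "(real ^ 'n \<Rightarrow> real) \<Rightarrow> (real ^ 'n \<Rightarrow> real ^ 'n \<Rightarrow> real) \<Rightarrow> bool" where
  "deimling N W \<longleftrightarrow>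
     (\<forall>x y. W x y \<le> N y * Lim (at_right 0) (\<lambda>h. (N (y + h *\<^sub>R x) - N y) / h))"

(* The supremum is taken in ereal; when C has at most one point it is -\<infinity>. *)
definition osL ::
    "(real ^ 'n \<Rightarrow> real) \<Rightarrow> (real ^ 'n \<Rightarrow> real ^ 'n \<Rightarrow> real) \<Rightarrow> (real ^ 'n) set
       \<Rightarrow> (real ^ 'n \<Rightarrow> real ^ 'n) \<Rightarrow> ereal" where
  "osL N W C g =
     (SUP (x, y) \<in> {(x, y). x \<in> C \<and> y \<in> C \<and> x \<noteq> y}.
        ereal (W (g x - g y) (x - y) / (N (x - y))\<^sup>2))"

definition induced_norm :: "(real ^ 'n \<Rightarrow> real) \<Rightarrow> real ^ 'n ^ 'n \<Rightarrow> real" where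
  "induced_norm N A = (SUP v \<in> {v. N v = 1}. N (A *v v))"

(* For a norm N the limit always exists, by convexity of the induced norm. *)
definition log_norm :: "(real ^ 'n \<Rightarrow> real) \<Rightarrow> real ^ 'n ^ 'n \<Rightarrow> real" where
  "log_norm N A = Lim (at_right 0) (\<lambda>h. (induced_norm N (mat 1 + h *\<^sub>R A) - 1) / h)"

definition upper_right_dini :: "(real \<Rightarrow> real) \<Rightarrow> real \<Rightarrow> ereal" where
  "upper_right_dini u t = Limsup (at_right 0) (\<lambda>h. ereal ((u (t + h) - u t) / h))"

(* A solution on the half-open interval [t0, T).  "The solution starting at (t0, x0) exists
   at time t" means that this holds for some T > t.  At t0 the derivative is one-sided. *)
definition solution ::
    "(real \<Rightarrow> real ^ 'n \<Rightarrow> real ^ 'n) \<Rightarrow> real \<Rightarrow> real \<Rightarrow> real ^ 'n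
       \<Rightarrow> (real \<Rightarrow> real ^ 'n) \<Rightarrow> bool" where
  "solution f t0 T x0 \<phi> \<longleftrightarrow>
     t0 < T \<and> \<phi> t0 = x0 \<and>
     (\<forall>t\<in>{t0..<T}. (\<phi> has_vector_derivative f t (\<phi> t)) (at t within {t0..<T}))"

definition forward_invariant ::
    "(real \<Rightarrow> real ^ 'n \<Rightarrow> real ^ 'n) \<Rightarrow> (real ^ 'n) set \<Rightarrow> bool" where
  "forward_invariant f C \<longleftrightarrow>
     (\<forall>t0\<ge>0. \<forall>T. \<forall>x0\<in>C. \<forall>\<phi>. solution f t0 T x0 \<phi> \<longrightarrow> (\<forall>t\<in>{t0..<T}. \<phi> t \<in> C))"

definition all_equivalent :: "bool list \<Rightarrow> bool" where
  "all_equivalent Ps \<longleftrightarrow> (\<forall>P\<in>set Ps. \<forall>Q\<in>set Ps. P \<longleftrightarrow> Q)"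

end

theory Submission
  imports Defs
begin

text \<open>The conditions are proved to imply one another in the cyclic order in which they are listed.

The central quantity is the one-sided derivative \<open>q\<close> of the norm at a point \<open>e\<close>, as a function of the
direction. It exists, and it is convex, because the norm is convex. Three facts connect it with
the conditions. Along two solutions, the upper right Dini derivative of the distance is \<open>q\<close> at
\<open>e = \<phi> t - \<psi> t\<close> in the direction \<open>f t (\<phi> t) - f t (\<psi> t)\<close>. In a direction \<open>A e\<close> the value \<open>q (A e)\<close> is at
most \<open>\<mu>(A) N(e)\<close>, by the definition of the logarithmic norm. Deimling's inequality says that
\<open>W x e\<close> is at most \<open>N(e) q(x)\<close>.

The one-sided Lipschitz condition gives the bound on the derivative by dividing by the squared step
along a segment. The bound on \<open>W (A v) v\<close> gives \<open>\<mu>(A) \<le> b\<close> by Lumer's argument: subadditivity, homogeneity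
and the Cauchy-Schwarz inequality for \<open>W\<close> show that \<open>I - h A\<close> expands by at least \<open>1 - h b\<close>, and
\<open>(I - h A) (I + h A)\<close> is the identity up to order \<open>h\<^sup>2\<close>. From a bound on the logarithmic norm over \<open>C\<close>, the
convexity of \<open>q\<close> and a mean value inequality along the segment between two solutions bound the Dini
derivative of their distance. A comparison argument turns this into the exponential bound.

The return from solutions to the vector field needs solutions with prescribed initial values. The
field is only separately continuous in time and space: it may fail to be locally Lipschitz in
space uniformly for times near a given time, so that the existence of a solution from that initial
time is in doubt. Baire's theorem helps: the times at which a given Lipschitz constant on a
fixed ball is valid form a closed set, the sets for all constants cover the half-line, hence every
interval of times contains a subinterval with a uniform constant, and there Picard iteration
applies. So solutions start at a dense set of times (\<open>solutions_start_at_nearby_time\<close>). At such a time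
the exponential bound is differentiated at the initial time, and Deimling's inequality yields the
one-sided Lipschitz estimate for the given pair of points. For a fixed pair that estimate is a
closed condition on the time, by continuity of the field in time and of \<open>W\<close> in its first
argument, so it holds at all times.\<close>

section \<open>Norms and induced norms\<close>

lemma is_norm_nonneg: "is_norm N \<Longrightarrow> 0 \<le> N x"
  and is_norm_eq_0: "is_norm N \<Longrightarrow> N x = 0 \<longleftrightarrow> x = 0"
  and is_norm_scaleR: "is_norm N \<Longrightarrow> N (c *\<^sub>R x) = \<bar>c\<bar> * N x"
  and is_norm_triangle: "is_norm N \<Longrightarrow> N (x + y) \<le> N x + N y"
  by (auto simp: is_norm_def)

lemma is_norm_zero: "is_norm N \<Longrightarrow> N 0 = 0"
  by (simp add: is_norm_eq_0)

lemma is_norm_pos: "is_norm N \<Longrightarrow> x \<noteq> 0 \<Longrightarrow> 0 < N x"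
  using is_norm_nonneg[of N x] is_norm_eq_0[of N x] by linarith

lemma is_norm_diff_le:
  assumes "is_norm N"
  shows "N x - N y \<le> N (x - y)"
  using is_norm_triangle[OF assms, of "x - y" y] by simp

lemma is_norm_convex:
  assumes "is_norm N" "0 \<le> u" "0 \<le> v"
  shows "N (u *\<^sub>R x + v *\<^sub>R y) \<le> u * N x + v * N y"
  using is_norm_triangle[OF assms(1), of "u *\<^sub>R x" "v *\<^sub>R y"] assms
  by (simp add: is_norm_scaleR)

lemma is_norm_convex_on:
  assumes "is_norm N"
  shows "convex_on UNIV N"
  by (rule convex_onI) (auto intro: is_norm_convex[OF assms])

lemma is_norm_continuous:
  assumes "is_norm N"
  shows "continuous_on UNIV N"
  using convex_on_continuous[OF open_UNIV is_norm_convex_on[OF assms]] .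

lemma compact_unit_sphere:
  assumes "is_norm N"
  shows "compact {v. N v = 1}"
proof -
  have c: "continuous_on S N" for S
    using is_norm_continuous[OF assms] continuous_on_subset by blast
  obtain z where z: "z \<in> sphere 0 1" "\<And>v. v \<in> sphere 0 1 \<Longrightarrow> N z \<le> N v"
    using continuous_attains_inf[OF compact_sphere _ c, of 0 1] by auto
  have pos: "0 < N z" using z(1) by (intro is_norm_pos[OF assms]) auto
  have "norm v \<le> 1 / N z" if v: "N v = 1" for v
  proof -
    have "v \<noteq> 0" using v is_norm_zero[OF assms] by auto
    then have "N z \<le> N ((1 / norm v) *\<^sub>R v)" by (intro z(2)) auto
    then show ?thesis using v \<open>v \<noteq> 0\<close> pos
      by (simp add: is_norm_scaleR[OF assms] field_simps)
  qed
  then have "bounded {v. N v = 1}" by (auto simp: bounded_iff)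
  moreover have "closed {v. N v = 1}"
    using continuous_closed_preimage_constant[OF c closed_UNIV, of 1] by simp
  ultimately show ?thesis by (simp add: compact_eq_bounded_closed)
qed

lemma unit_sphere_nonempty:
  assumes "is_norm N"
  shows "{v. N v = 1} \<noteq> {}"
proof -
  let ?e = "axis undefined (1::real)"
  have "0 < N ?e" by (intro is_norm_pos[OF assms]) (simp add: axis_eq_0_iff)
  then have "N ((1 / N ?e) *\<^sub>R ?e) = 1" by (simp add: is_norm_scaleR[OF assms])
  then show ?thesis by blast
qed

lemma bdd_above_operator_values:
  assumes "is_norm N"
  shows "bdd_above ((\<lambda>v. N (A *v v)) ` {v. N v = 1})"
proof -
  have "continuous_on {v. N v = 1} (\<lambda>v. N (A *v v))"
    by (rule continuous_on_compose2[OF is_norm_continuous[OF assms]])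
       (auto intro: linear_continuous_on matrix_vector_mul_bounded_linear)
  from compact_continuous_image[OF this compact_unit_sphere[OF assms]] show ?thesis
    by (rule bounded_imp_bdd_above[OF compact_imp_bounded])
qed

lemma induced_norm_bound:
  assumes "is_norm N"
  shows "N (A *v v) \<le> induced_norm N A * N v"
proof (cases "v = 0")
  case True
  then show ?thesis by (simp add: is_norm_zero[OF assms])
next
  case False
  then have pos: "0 < N v" by (rule is_norm_pos[OF assms])
  let ?w = "(1 / N v) *\<^sub>R v"
  have "N ?w = 1" using pos by (simp add: is_norm_scaleR[OF assms])
  then have "N (A *v ?w) \<le> induced_norm N A"
    unfolding induced_norm_def
    by (intro cSUP_upper bdd_above_operator_values[OF assms]) auto
  then show ?thesis
    using pos by (simp add: matrix_vector_mult_scaleR is_norm_scaleR[OF assms] field_simps)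
qed

lemma induced_norm_least:
  assumes "is_norm N" and "\<And>v. N (A *v v) \<le> c * N v"
  shows "induced_norm N A \<le> c"
  unfolding induced_norm_def
proof (rule cSUP_least[OF unit_sphere_nonempty[OF assms(1)]])
  fix v assume "v \<in> {v. N v = 1}"
  then show "N (A *v v) \<le> c" using assms(2)[of v] by simp
qed

lemma induced_norm_id:
  fixes N :: "real ^ 'n \<Rightarrow> real"
  assumes "is_norm N"
  shows "induced_norm N (mat 1) = 1"
  unfolding induced_norm_def using unit_sphere_nonempty[OF assms] by simp

text \<open>Pointwise convexity of \<open>h \<mapsto> N ((I + h A) v)\<close> passes to the supremum over \<open>v\<close>. This convexity is what
makes the limit that defines the logarithmic norm exist.\<close>

lemma induced_norm_convex_line:
  assumes "is_norm N"
  shows "convex_on UNIV (\<lambda>h. induced_norm N (mat 1 + h *\<^sub>R A))"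
proof (rule convex_onI; simp?)
  fix t h h' :: real assume t: "0 < t" "t < 1"
  let ?M = "\<lambda>h. mat 1 + h *\<^sub>R A"
  show "induced_norm N (?M ((1 - t) * h + t * h'))
     \<le> (1 - t) * induced_norm N (?M h) + t * induced_norm N (?M h')"
  proof (rule induced_norm_least[OF assms])
    fix v
    have "?M ((1 - t) * h + t * h') *v v
        = (1 - t) *\<^sub>R (?M h *v v) + t *\<^sub>R (?M h' *v v)"
      by (simp add: matrix_vector_mult_add_rdistrib scaleR_matrix_vector_assoc[symmetric] algebra_simps)
    then have "N (?M ((1 - t) * h + t * h') *v v)
        \<le> (1 - t) * N (?M h *v v) + t * N (?M h' *v v)"
      using t by (simp add: is_norm_convex[OF assms])
    also have "\<dots> \<le> (1 - t) * (induced_norm N (?M h) * N v) + t * (induced_norm N (?M h') * N v)"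
      using t by (intro add_mono mult_left_mono induced_norm_bound[OF assms]) auto
    finally show "N (?M ((1 - t) * h + t * h') *v v)
        \<le> ((1 - t) * induced_norm N (?M h) + t * induced_norm N (?M h')) * N v"
      by (simp add: algebra_simps)
  qed
qed

section \<open>One-sided derivatives of norms and the logarithmic norm\<close>

text \<open>Difference quotients of a convex function increase with the step and are bounded below by the slope
from \<open>-1\<close> to \<open>0\<close>, so they converge to their infimum. Stating the limit through \<open>Lim\<close> shows that the
value chosen by \<open>Lim\<close> in the definitions of the logarithmic norm and of Deimling's inequality is
the actual limit.\<close>

lemma convex_right_slope_tendsto:
  fixes k :: "real \<Rightarrow> real"
  assumes "convex_on UNIV k"
  shows "((\<lambda>h. (k h - k 0) / h) \<longlongrightarrow> Lim (at_right 0) (\<lambda>h. (k h - k 0) / h)) (at_right 0)"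
proof -
  let ?s = "\<lambda>h. (k h - k 0) / h"
  have mono: "?s h \<le> ?s h'" if "0 < h" "h \<le> h'" for h h'
  proof (cases "h = h'")
    case False
    then show ?thesis
      using convex_on_slope_le(1)[OF assms, of 0 h' h] that by (simp add: field_simps)
  qed simp
  have bound: "k 0 - k (-1) \<le> ?s h" if "0 < h" for h
  proof -
    have "(k (-1) - k 0) / (-1 - 0) \<le> (k (-1) - k h) / (-1 - h)"
      and "(k (-1) - k h) / (-1 - h) \<le> (k 0 - k h) / (0 - h)"
      using convex_on_slope_le[OF assms, of "-1" h 0] that by auto
    then show ?thesis using that by (simp add: field_simps)
  qed
  let ?L = "Inf (?s ` {0<..})"
  have bdd: "bdd_below (?s ` {0<..})"
    using bound by (intro bdd_belowI2[of _ "k 0 - k (-1)"]) auto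
  have "(?s \<longlongrightarrow> ?L) (at_right 0)"
  proof (rule order_tendstoI)
    fix a assume "a < ?L"
    then have "a < ?s h" if "0 < h" for h
      using cINF_lower[OF bdd, of h] that by auto
    then show "\<forall>\<^sub>F h in at_right 0. a < ?s h"
      by (auto simp: eventually_at_right_field intro!: exI[of _ 1])
  next
    fix a assume "?L < a"
    then obtain h where h: "0 < h" "?s h < a"
      using cInf_lessD[of "?s ` {0<..}" a] by auto
    have "?s h' < a" if "0 < h'" "h' < h" for h'
      using mono[of h' h] that h by linarith
    with h(1) show "\<forall>\<^sub>F h' in at_right 0. ?s h' < a"
      by (auto simp: eventually_at_right_field)
  qed
  then show ?thesis by (simp only: tendsto_Lim[OF trivial_limit_at_right_real])
qed

definition norm_right_deriv :: "(real ^ 'n \<Rightarrow> real) \<Rightarrow> real ^ 'n \<Rightarrow> real ^ 'n \<Rightarrow> real" where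
  "norm_right_deriv N y x = Lim (at_right 0) (\<lambda>h. (N (y + h *\<^sub>R x) - N y) / h)"

lemma norm_right_deriv_tendsto:
  assumes "is_norm N"
  shows "((\<lambda>h. (N (y + h *\<^sub>R x) - N y) / h) \<longlongrightarrow> norm_right_deriv N y x) (at_right 0)"
proof -
  have "convex_on UNIV (\<lambda>h. N (y + h *\<^sub>R x))"
  proof (rule convex_onI; simp?)
    fix t h h' :: real assume t: "0 < t" "t < 1"
    have "y + ((1 - t) * h + t * h') *\<^sub>R x = (1 - t) *\<^sub>R (y + h *\<^sub>R x) + t *\<^sub>R (y + h' *\<^sub>R x)"
      by (simp add: algebra_simps)
    then show "N (y + ((1 - t) * h + t * h') *\<^sub>R x)
        \<le> (1 - t) * N (y + h *\<^sub>R x) + t * N (y + h' *\<^sub>R x)"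
      using t by (simp add: is_norm_convex[OF assms])
  qed
  from convex_right_slope_tendsto[OF this] show ?thesis
    by (simp add: norm_right_deriv_def)
qed

text \<open>Each difference quotient is a convex function of the direction, and so is their limit.\<close>

lemma norm_right_deriv_convex_on:
  assumes "is_norm N"
  shows "convex_on UNIV (norm_right_deriv N y)"
proof (rule convex_onI; simp?)
  fix t :: real and x x' :: "real ^ 'a" assume t: "0 < t" "t < 1"
  let ?s = "\<lambda>x h. (N (y + h *\<^sub>R x) - N y) / h"
  let ?z = "(1 - t) *\<^sub>R x + t *\<^sub>R x'"
  have lim: "((\<lambda>h. (1 - t) * ?s x h + t * ?s x' h)
      \<longlongrightarrow> (1 - t) * norm_right_deriv N y x + t * norm_right_deriv N y x') (at_right 0)"
    by (intro tendsto_intros norm_right_deriv_tendsto[OF assms])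
  have "?s ?z h \<le> (1 - t) * ?s x h + t * ?s x' h" if "0 < h" for h
  proof -
    have "y + h *\<^sub>R ?z = (1 - t) *\<^sub>R (y + h *\<^sub>R x) + t *\<^sub>R (y + h *\<^sub>R x')"
      by (simp add: algebra_simps)
    then have "N (y + h *\<^sub>R ?z) \<le> (1 - t) * N (y + h *\<^sub>R x) + t * N (y + h *\<^sub>R x')"
      using t by (simp add: is_norm_convex[OF assms])
    then have "?s ?z h \<le> ((1 - t) * N (y + h *\<^sub>R x) + t * N (y + h *\<^sub>R x') - N y) / h"
      using that by (intro divide_right_mono) auto
    also have "\<dots> = (1 - t) * ?s x h + t * ?s x' h"
      using that by (simp add: field_simps)
    finally show ?thesis .
  qed
  then have "\<forall>\<^sub>F h in at_right 0. ?s ?z h \<le> (1 - t) * ?s x h + t * ?s x' h"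
    by (auto simp: eventually_at_right_field intro!: exI[of _ 1])
  then show "norm_right_deriv N y ?z \<le> (1 - t) * norm_right_deriv N y x + t * norm_right_deriv N y x'"
    using tendsto_le[OF trivial_limit_at_right_real lim norm_right_deriv_tendsto[OF assms]] by blast
qed

lemma log_norm_tendsto:
  assumes "is_norm N"
  shows "((\<lambda>h. (induced_norm N (mat 1 + h *\<^sub>R A) - 1) / h) \<longlongrightarrow> log_norm N A) (at_right 0)"
  using convex_right_slope_tendsto[OF induced_norm_convex_line[OF assms, of A]]
  by (simp add: log_norm_def induced_norm_id[OF assms])

text \<open>The difference quotients satisfy the inequality for every step, since
\<open>N (v + h A v) \<le> \<parallel>I + h A\<parallel> N v\<close>.\<close>

lemma norm_right_deriv_le_log_norm:
  assumes "is_norm N"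
  shows "norm_right_deriv N v (A *v v) \<le> log_norm N A * N v"
proof (rule tendsto_le[OF trivial_limit_at_right_real])
  show "((\<lambda>h. (induced_norm N (mat 1 + h *\<^sub>R A) - 1) / h * N v) \<longlongrightarrow> log_norm N A * N v) (at_right 0)"
    by (intro tendsto_intros log_norm_tendsto[OF assms])
  show "((\<lambda>h. (N (v + h *\<^sub>R (A *v v)) - N v) / h) \<longlongrightarrow> norm_right_deriv N v (A *v v)) (at_right 0)"
    by (rule norm_right_deriv_tendsto[OF assms])
  have "(N (v + h *\<^sub>R (A *v v)) - N v) / h \<le> (induced_norm N (mat 1 + h *\<^sub>R A) - 1) / h * N v"
    if "0 < h" for h
  proof -
    have "N (v + h *\<^sub>R (A *v v)) \<le> induced_norm N (mat 1 + h *\<^sub>R A) * N v"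
      using induced_norm_bound[OF assms, of "mat 1 + h *\<^sub>R A" v]
      by (simp add: matrix_vector_mult_add_rdistrib scaleR_matrix_vector_assoc)
    then show ?thesis using that by (simp add: field_simps)
  qed
  then show "\<forall>\<^sub>F h in at_right 0. (N (v + h *\<^sub>R (A *v v)) - N v) / h
      \<le> (induced_norm N (mat 1 + h *\<^sub>R A) - 1) / h * N v"
    by (auto simp: eventually_at_right_field intro!: exI[of _ 1])
qed

section \<open>A mean value inequality for convex functionals\<close>

text \<open>A convex functional \<open>p\<close> is continuous, so \<open>{u. p u \<le> B}\<close> is closed and convex. If the increment
\<open>g x - g y\<close> were outside, a hyperplane would separate it from this set, and the scalar mean value
theorem for the normal component of \<open>g\<close> on the segment would give a derivative value on the wrong
side. It plays the part of the integral form of the mean value theorem followed by Jensen's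
inequality.\<close>

lemma convex_mean_value_inequality:
  fixes p :: "'a::euclidean_space \<Rightarrow> real" and g :: "'b::real_normed_vector \<Rightarrow> 'a"
  assumes p: "convex_on UNIV p" and S: "convex S" "x \<in> S" "y \<in> S"
    and deriv: "\<And>z. z \<in> S \<Longrightarrow> (g has_derivative g' z) (at z)"
    and bound: "\<And>z. z \<in> S \<Longrightarrow> p (g' z (x - y)) \<le> B"
  shows "p (g x - g y) \<le> B"
proof (rule ccontr)
  assume not_le: "\<not> p (g x - g y) \<le> B"
  let ?K = "{u. p u \<le> B}"
  have "convex ?K"
  proof (rule convexI)
    fix u v a c assume h: "u \<in> ?K" "v \<in> ?K" "(0::real) \<le> a" "0 \<le> c" "a + c = 1"
    have "p (a *\<^sub>R u + c *\<^sub>R v) \<le> a * p u + c * p v"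
      using h p by (simp add: convex_on_def)
    also have "\<dots> \<le> a * B + c * B" using h by (intro add_mono mult_left_mono) auto
    also have "\<dots> = B" using h(5) by (metis distrib_right mult_1)
    finally show "a *\<^sub>R u + c *\<^sub>R v \<in> ?K" by simp
  qed
  moreover have "closed ?K"
    using closed_Collect_le[OF convex_on_continuous[OF open_UNIV p] continuous_on_const] by simp
  ultimately obtain a c where a: "a \<bullet> (g x - g y) < c" "\<And>u. p u \<le> B \<Longrightarrow> c < a \<bullet> u"
    using separating_hyperplane_closed_point[of ?K "g x - g y"] not_le by auto
  let ?z = "\<lambda>s. y + s *\<^sub>R (x - y)"
  have in_S: "?z s \<in> S" if "0 \<le> s" "s \<le> 1" for s
  proof -
    have "?z s = (1 - s) *\<^sub>R y + s *\<^sub>R x" by (simp add: algebra_simps)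
    then show ?thesis using convexD[OF S(1) S(3) S(2), of "1 - s" s] that by simp
  qed
  have "\<exists>s\<in>{0<..<1}. a \<bullet> g (?z 1) - a \<bullet> g (?z 0) = a \<bullet> g' (?z s) ((1 - 0) *\<^sub>R (x - y))"
  proof (rule mvt_simple[where f = "\<lambda>s. a \<bullet> g (?z s)"
        and f' = "\<lambda>s h. a \<bullet> g' (?z s) (h *\<^sub>R (x - y))"])
    fix s :: real assume s: "0 \<le> s" "s \<le> 1"
    have "((\<lambda>s. g (?z s)) has_derivative (\<lambda>h. g' (?z s) (h *\<^sub>R (x - y)))) (at s within {0..1})"
      by (rule has_derivative_compose[where f = ?z and g = g and g' = "g' (?z s)" and x = s, OF _ deriv[OF in_S[OF s]]])
         (auto intro!: derivative_eq_intros)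
    then show "((\<lambda>s. a \<bullet> g (?z s)) has_derivative (\<lambda>h. a \<bullet> g' (?z s) (h *\<^sub>R (x - y))))
        (at s within {0..1})"
      by (rule has_derivative_inner_right)
  qed simp
  then obtain s where s: "s \<in> {0<..<1}" "a \<bullet> (g x - g y) = a \<bullet> g' (?z s) (x - y)"
    by (auto simp: inner_diff_right)
  with a(2)[OF bound[OF in_S, of s]] a(1) show False by simp
qed

text \<open>The mean value inequality applies to the derivative of the norm at the fixed point \<open>x - y\<close>, which is
convex in the direction; in the directions \<open>J z (x - y)\<close> it is bounded through the logarithmic norm.\<close>

lemma norm_right_deriv_difference_le:
  assumes N: "is_norm N" and C: "convex C" "x \<in> C" "y \<in> C"
    and deriv: "\<And>z. z \<in> C \<Longrightarrow> (g has_derivative (\<lambda>v. J z *v v)) (at z)"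
    and log_norm: "\<And>z. z \<in> C \<Longrightarrow> log_norm N (J z) \<le> b"
  shows "norm_right_deriv N (x - y) (g x - g y) \<le> b * N (x - y)"
proof (rule convex_mean_value_inequality[OF norm_right_deriv_convex_on[OF N] C deriv])
  fix z assume "z \<in> C"
  have "norm_right_deriv N (x - y) (J z *v (x - y)) \<le> log_norm N (J z) * N (x - y)"
    by (rule norm_right_deriv_le_log_norm[OF N])
  also have "\<dots> \<le> b * N (x - y)"
    using log_norm[OF \<open>z \<in> C\<close>] is_norm_nonneg[OF N] by (intro mult_right_mono)
  finally show "norm_right_deriv N (x - y) (J z *v (x - y)) \<le> b * N (x - y)" .
qed

section \<open>The norm along a differentiable curve\<close>

text \<open>The norm is Lipschitz with respect to itself, so replacing the curve by its tangent changes the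
difference quotient by at most the norm of the linearization error divided by the step.\<close>

lemma norm_along_curve_tendsto:
  assumes N: "is_norm N" and t: "t \<in> {t0..<T}"
    and w: "(w has_vector_derivative d) (at t within {t0..<T})"
  shows "((\<lambda>h. (N (w (t + h)) - N (w t)) / h) \<longlongrightarrow> norm_right_deriv N (w t) d) (at_right 0)"
proof -
  define e where "e h = (1 / h) *\<^sub>R (w (t + h) - (w t + h *\<^sub>R d))" for h
  have "(w has_vector_derivative d) (at t within {t..(t + T) / 2})"
    by (rule has_vector_derivative_within_subset[OF w]) (use t in auto)
  then have "((\<lambda>y. (1 / norm (y - t)) *\<^sub>R (w y - (w t + (y - t) *\<^sub>R d))) \<longlongrightarrow> 0) (at_right t)"
    using t by (simp add: has_vector_derivative_def has_derivative_within at_within_Icc_at_right)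
  then have "((\<lambda>h. (1 / norm h) *\<^sub>R (w (t + h) - (w t + h *\<^sub>R d))) \<longlongrightarrow> 0) (at_right 0)"
    by (simp add: at_right_to_0[of t] filterlim_filtermap add.commute)
  then have e0: "(e \<longlongrightarrow> 0) (at_right 0)"
    by (rule Lim_transform_eventually)
       (auto simp: eventually_at_right_field e_def intro!: exI[of _ 1])
  have Ne0: "((\<lambda>h. N (e h)) \<longlongrightarrow> 0) (at_right 0)"
  proof -
    have "isCont N 0"
      using is_norm_continuous[OF N] by (simp add: continuous_on_eq_continuous_at)
    from isCont_tendsto_compose[OF this e0] show ?thesis by (simp add: is_norm_zero[OF N])
  qed
  have "((\<lambda>h. (N (w (t + h)) - N (w t)) / h - (N (w t + h *\<^sub>R d) - N (w t)) / h) \<longlongrightarrow> 0) (at_right 0)"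
  proof (rule Lim_null_comparison[OF _ Ne0])
    have "norm ((N (w (t + h)) - N (w t)) / h - (N (w t + h *\<^sub>R d) - N (w t)) / h) \<le> N (e h)"
      if h: "0 < h" for h
    proof -
      let ?a = "w (t + h)" and ?b = "w t + h *\<^sub>R d"
      have "N (h *\<^sub>R e h) = h * N (e h)" "N (- (h *\<^sub>R e h)) = h * N (e h)"
        using is_norm_scaleR[OF N, of h "e h"] is_norm_scaleR[OF N, of "- h" "e h"] h by auto
      moreover have "h *\<^sub>R e h = ?a - ?b" using h by (simp add: e_def)
      ultimately have "\<bar>N ?a - N ?b\<bar> \<le> h * N (e h)"
        using is_norm_diff_le[OF N, of ?a ?b] is_norm_diff_le[OF N, of ?b ?a] by auto
      then show ?thesis using h
        by (simp add: diff_divide_distrib[symmetric] field_simps)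
    qed
    then show "\<forall>\<^sub>F h in at_right 0.
      norm ((N (w (t + h)) - N (w t)) / h - (N (w t + h *\<^sub>R d) - N (w t)) / h) \<le> N (e h)"
      by (auto simp: eventually_at_right_field intro!: exI[of _ 1])
  qed
  from tendsto_add[OF this norm_right_deriv_tendsto[OF N, of "w t" d]] show ?thesis by simp
qed

section \<open>Weak pairings\<close>

lemma pairing_le_right_deriv:
  assumes "deimling N W"
  shows "W x y \<le> N y * norm_right_deriv N y x"
  using assms by (simp add: deimling_def norm_right_deriv_def)

lemma osL_le_iff:
  assumes "is_norm N"
  shows "osL N W C g \<le> ereal b \<longleftrightarrow>
    (\<forall>x\<in>C. \<forall>y\<in>C. x \<noteq> y \<longrightarrow> W (g x - g y) (x - y) \<le> b * (N (x - y))\<^sup>2)"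
proof -
  have "W (g x - g y) (x - y) / (N (x - y))\<^sup>2 \<le> b \<longleftrightarrow> W (g x - g y) (x - y) \<le> b * (N (x - y))\<^sup>2"
    if "x \<noteq> y" for x y
    using is_norm_pos[OF assms, of "x - y"] that by (simp add: divide_le_eq)
  then show ?thesis by (auto simp: osL_def SUP_le_iff)
qed

text \<open>Homogeneity in both arguments turns the estimate for \<open>x\<close> and \<open>x + h v\<close> into an estimate for the
difference quotient paired with \<open>v\<close>; continuity of the pairing in its first argument then allows
\<open>h\<close> to tend to zero.\<close>

lemma pairing_derivative_le:
  assumes W: "weak_pairing W" and N: "is_norm N"
    and C: "open C" "x \<in> C" and g: "(g has_derivative g') (at x)"
    and osl: "\<And>y. y \<in> C \<Longrightarrow> y \<noteq> x \<Longrightarrow> W (g y - g x) (y - x) \<le> b * (N (y - x))\<^sup>2"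
  shows "W (g' v) v \<le> b * (N v)\<^sup>2"
proof (cases "v = 0")
  case True
  have "W x 0 = 0" for x
    using W[unfolded weak_pairing_def] by (metis mult_zero_left order_refl scaleR_zero_left)
  then show ?thesis using True by (simp add: is_norm_zero[OF N])
next
  case v: False
  let ?q = "\<lambda>h. (1 / h) *\<^sub>R (g (x + h *\<^sub>R v) - g x)"
  have "((\<lambda>h. g (x + h *\<^sub>R v)) has_vector_derivative g' v) (at 0 within {0..1})"
  proof -
    have "((\<lambda>h. g (x + h *\<^sub>R v)) has_derivative (\<lambda>h. g' (h *\<^sub>R v))) (at 0)"
      by (rule has_derivative_compose[where f = "\<lambda>h. x + h *\<^sub>R v" and g = g and g' = g'])
         (use g in \<open>auto intro!: derivative_eq_intros\<close>)
    moreover have "g' (h *\<^sub>R v) = h *\<^sub>R g' v" for h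
      using has_derivative_linear[OF g] by (rule linear_scale)
    ultimately show ?thesis
      by (simp add: has_vector_derivative_def has_derivative_at_withinI)
  qed
  then have "((\<lambda>h. (1 / norm h) *\<^sub>R (g (x + h *\<^sub>R v) - (g x + h *\<^sub>R g' v))) \<longlongrightarrow> 0) (at_right 0)"
    by (simp add: has_vector_derivative_def has_derivative_within at_within_Icc_at_right)
  then have "((\<lambda>h. ?q h - g' v) \<longlongrightarrow> 0) (at_right 0)"
    by (rule Lim_transform_eventually)
       (auto simp: eventually_at_right_field algebra_simps intro!: exI[of _ 1])
  then have q: "(?q \<longlongrightarrow> g' v) (at_right 0)"
    by (simp add: LIM_zero_iff)
  have "isCont (\<lambda>u. W u v) (g' v)"
    using W by (simp add: weak_pairing_def continuous_on_eq_continuous_at)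
  from isCont_tendsto_compose[OF this q]
  have lim: "((\<lambda>h. W (?q h) v) \<longlongrightarrow> W (g' v) v) (at_right 0)" .
  have "((\<lambda>h. x + h *\<^sub>R v) \<longlongrightarrow> x + 0 *\<^sub>R v) (at_right 0)"
    by (intro tendsto_intros)
  then have "\<forall>\<^sub>F h in at_right 0. x + h *\<^sub>R v \<in> C"
    using topological_tendstoD[of _ x, OF _ C] by simp
  then have "\<forall>\<^sub>F h in at_right 0. W (?q h) v \<le> b * (N v)\<^sup>2"
    using eventually_at_right_less[of "0::real"]
  proof eventually_elim
    case (elim h)
    have hom: "W (h *\<^sub>R a) (h *\<^sub>R v) = h * (h * W a v)" for a
      using W elim by (simp add: weak_pairing_def)
    have "g (x + h *\<^sub>R v) - g x = h *\<^sub>R ?q h" using elim by simp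
    moreover have "W (g (x + h *\<^sub>R v) - g x) (h *\<^sub>R v) \<le> b * (N (h *\<^sub>R v))\<^sup>2"
      using osl[of "x + h *\<^sub>R v"] elim v by simp
    ultimately have "h * (h * W (?q h) v) \<le> b * (h * N v)\<^sup>2"
      using elim by (metis hom is_norm_scaleR[OF N] abs_of_pos)
    also have "\<dots> = h * (h * (b * (N v)\<^sup>2))" by (simp add: power2_eq_square)
    finally show ?case using elim by (simp del: mult_less_0_iff)
  qed
  then show ?thesis
    using tendsto_upperbound[OF lim _ trivial_limit_at_right_real] by blast
qed

text \<open>One direction of Lumer's formula for the logarithmic norm. Inverting \<open>I - h A\<close> is avoided by applying
the expansion estimate to \<open>(I + h A) v\<close>.\<close>

lemma log_norm_le_of_pairing:
  assumes N: "is_norm N" and W: "weak_pairing W" "compatible_pairing N W"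
    and A: "\<And>v. W (A *v v) v \<le> b * (N v)\<^sup>2"
  shows "log_norm N A \<le> b"
proof -
  \<comment> \<open>Expansion of \<open>I - h A\<close>, from pairing \<open>w = (w - h A w) + h A w\<close> with \<open>w\<close>.\<close>
  have lower: "(1 - h * b) * N w \<le> N (w - h *\<^sub>R (A *v w))" if h: "0 < h" for h w
  proof (cases "w = 0")
    case True
    then show ?thesis by (simp add: is_norm_zero[OF N])
  next
    case False
    then have pos: "0 < N w" by (rule is_norm_pos[OF N])
    let ?r = "w - h *\<^sub>R (A *v w)"
    have WN: "W u u = (N u)\<^sup>2" for u using W(2) by (simp add: compatible_pairing_def)
    have cs: "\<bar>W ?r w\<bar> \<le> sqrt (W ?r ?r) * sqrt (W w w)"
      using W(1) unfolding weak_pairing_def by blast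
    have "W (?r + h *\<^sub>R (A *v w)) w \<le> W ?r w + W (h *\<^sub>R (A *v w)) w"
      using W(1) unfolding weak_pairing_def by blast
    moreover have "W (h *\<^sub>R (A *v w)) w = h * W (A *v w) w"
      using W(1) h unfolding weak_pairing_def by simp
    moreover have "h * W (A *v w) w \<le> h * (b * (N w)\<^sup>2)"
      using h A by (intro mult_left_mono) auto
    moreover have "W ?r w \<le> N ?r * N w"
      using cs by (simp add: WN is_norm_nonneg[OF N])
    ultimately have "(N w)\<^sup>2 \<le> N ?r * N w + h * (b * (N w)\<^sup>2)"
      using WN[of w] by simp
    then have "((1 - h * b) * N w) * N w \<le> N ?r * N w"
      by (simp add: power2_eq_square algebra_simps)
    then show ?thesis using pos by simp
  qed
  let ?k = "\<lambda>h. induced_norm N (mat 1 + h *\<^sub>R A)"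
  define c where "c = induced_norm N (A ** A)"
  have upper: "(?k h - 1) / h \<le> (h * c + b) / (1 - h * b)" if h: "0 < h" "h * b < 1" for h
  proof -
    have "?k h \<le> (1 + h\<^sup>2 * c) / (1 - h * b)"
    proof (rule induced_norm_least[OF N])
      fix v
      let ?w = "(mat 1 + h *\<^sub>R A) *v v"
      have w: "?w = v + h *\<^sub>R (A *v v)"
        by (simp add: matrix_vector_mult_add_rdistrib scaleR_matrix_vector_assoc)
      have "?w - h *\<^sub>R (A *v ?w) = v + (- h\<^sup>2) *\<^sub>R ((A ** A) *v v)"
        unfolding w
        by (simp add: matrix_vector_right_distrib matrix_vector_mult_scaleR
            matrix_vector_mul_assoc power2_eq_square algebra_simps)
      then have "(1 - h * b) * N ?w \<le> N (v + (- h\<^sup>2) *\<^sub>R ((A ** A) *v v))"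
        using lower[OF h(1), of ?w] by simp
      also have "\<dots> \<le> N v + h\<^sup>2 * N ((A ** A) *v v)"
        using is_norm_triangle[OF N, of v "(- h\<^sup>2) *\<^sub>R ((A ** A) *v v)"]
        by (simp only: is_norm_scaleR[OF N]) simp
      also have "\<dots> \<le> N v + h\<^sup>2 * (c * N v)"
        unfolding c_def by (intro add_left_mono mult_left_mono induced_norm_bound[OF N]) auto
      finally show "N ?w \<le> (1 + h\<^sup>2 * c) / (1 - h * b) * N v"
        using h by (simp add: field_simps)
    qed
    then have "?k h - 1 \<le> (1 + h\<^sup>2 * c) / (1 - h * b) - 1" by simp
    also have "\<dots> = h * ((h * c + b) / (1 - h * b))"
      using h by (simp add: field_simps power2_eq_square)
    finally show ?thesis using h by (simp add: pos_divide_le_eq mult.commute)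
  qed
  have lim: "((\<lambda>h. (h * c + b) / (1 - h * b)) \<longlongrightarrow> (0 * c + b) / (1 - 0 * b)) (at_right 0)"
    by (intro tendsto_intros) auto
  have "((\<lambda>h. h * b) \<longlongrightarrow> 0 * b) (at_right 0)" by (intro tendsto_intros)
  then have "\<forall>\<^sub>F h in at_right 0. h * b < 1" by (rule order_tendstoD) simp
  with eventually_at_right_less[of "0::real"]
  have "\<forall>\<^sub>F h in at_right 0. (?k h - 1) / h \<le> (h * c + b) / (1 - h * b)"
    by eventually_elim (rule upper)
  from tendsto_le[OF trivial_limit_at_right_real lim log_norm_tendsto[OF N] this]
  show ?thesis by simp
qed

section \<open>Growth bounds from Dini derivatives\<close>

text \<open>For a given \<open>\<epsilon>\<close>, the last point of the interval at which \<open>v r \<le> v s + \<epsilon> (r - s)\<close> exists by compactness;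
the growth hypothesis would move it further to the right unless it is already \<open>t\<close>.\<close>

lemma nonincreasing_of_right_growth:
  fixes v :: "real \<Rightarrow> real"
  assumes "s \<le> t" and cont: "continuous_on {s..t} v"
    and growth: "\<And>r \<epsilon>. s \<le> r \<Longrightarrow> r < t \<Longrightarrow> 0 < \<epsilon> \<Longrightarrow>
      \<forall>\<^sub>F h in at_right 0. v (r + h) \<le> v r + \<epsilon> * h"
  shows "v t \<le> v s"
proof (cases "s = t")
  case False
  then have st: "s < t" using assms by simp
  have claim: "v t \<le> v s + \<epsilon> * (t - s)" if e: "0 < \<epsilon>" for \<epsilon>
  proof (rule ccontr)
    assume not_le: "\<not> ?thesis"
    let ?S = "{r \<in> {s..t}. v r \<le> v s + \<epsilon> * (r - s)}"
    have "?S = {s..t} \<inter> (\<lambda>r. v r - \<epsilon> * (r - s)) -` {..v s}" by auto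
    moreover have "closed \<dots>"
      by (intro continuous_closed_preimage continuous_intros cont closed_atMost)
    ultimately have "closed ?S" by simp
    moreover have "bounded ?S"
      by (rule bounded_subset[OF bounded_closed_interval[of s t]]) auto
    ultimately have "compact ?S" by (simp add: compact_eq_bounded_closed)
    moreover have "s \<in> ?S" using st by simp
    ultimately obtain r where r: "r \<in> ?S" "\<And>r'. r' \<in> ?S \<Longrightarrow> r' \<le> r"
      using compact_attains_sup[of ?S] by blast
    have "r < t" using r(1) not_le by (cases "r = t") auto
    then have "\<forall>\<^sub>F h in at_right 0. h < t - r"
      by (auto simp: eventually_at_right_field intro!: exI[of _ "t - r"])
    moreover have "\<forall>\<^sub>F h in at_right 0. v (r + h) \<le> v r + \<epsilon> * h"
      using growth r(1) \<open>r < t\<close> e by auto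
    ultimately have "\<forall>\<^sub>F h in at_right 0. 0 < h \<and> h < t - r \<and> v (r + h) \<le> v r + \<epsilon> * h"
      using eventually_at_right_less[of "0::real"] by eventually_elim auto
    then obtain h where h: "0 < h" "h < t - r" "v (r + h) \<le> v r + \<epsilon> * h"
      using eventually_happens'[OF trivial_limit_at_right_real] by blast
    then have "r + h \<in> ?S" using r(1) by (auto simp: algebra_simps)
    with r(2) h(1) show False by force
  qed
  show ?thesis
  proof (rule field_le_epsilon)
    fix e :: real assume "0 < e"
    then show "v t \<le> v s + e" using claim[of "e / (t - s)"] st by simp
  qed
qed simp

text \<open>The function \<open>exp (- b r) u r\<close> has nonpositive upper right Dini derivative. The product rule is
carried out on difference quotients, as \<open>u\<close> itself need not be differentiable.\<close>

lemma exp_bound_of_dini: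
  assumes "s \<le> t" and cont: "continuous_on {s..t} u"
    and dini: "\<And>r. s \<le> r \<Longrightarrow> r < t \<Longrightarrow> upper_right_dini u r \<le> ereal (b * u r)"
  shows "u t \<le> exp (b * (t - s)) * u s"
proof -
  let ?v = "\<lambda>r. exp (- b * r) * u r"
  have "?v t \<le> ?v s"
  proof (rule nonincreasing_of_right_growth[OF assms(1)])
    show "continuous_on {s..t} ?v" by (intro continuous_intros cont)
    fix r \<epsilon> :: real assume r: "s \<le> r" "r < t" and e: "0 < \<epsilon>"
    \<comment> \<open>The slack left for \<open>u\<close>, scaled so that after multiplication by \<open>exp (- b r)\<close> only \<open>\<epsilon> / 2\<close> remains.\<close>
    define \<delta> where "\<delta> = \<epsilon> / 2 * exp (b * r)"
    have "0 < \<delta>" using e by (simp add: \<delta>_def)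
    then have "Limsup (at_right 0) (\<lambda>h. ereal ((u (r + h) - u r) / h)) < ereal (b * u r + \<delta>)"
      using dini[OF r] unfolding upper_right_dini_def
      by (metis ereal_less_eq(3) less_add_same_cancel1 less_ereal.simps(1) order_le_less_trans)
    then have slope: "\<forall>\<^sub>F h in at_right 0. (u (r + h) - u r) / h < b * u r + \<delta>"
      using Limsup_lessD by force
    let ?E = "\<lambda>h. exp (- b * (r + h))"
    have "((\<lambda>x. exp (- b * x)) has_real_derivative (exp (- b * r) * - b)) (at r)"
      by (auto intro!: derivative_eq_intros)
    then have "((\<lambda>h. (?E h - exp (- b * r)) / h) \<longlongrightarrow> exp (- b * r) * - b) (at 0)"
      by (simp add: DERIV_def)
    then have dE: "((\<lambda>h. (?E h - exp (- b * r)) / h) \<longlongrightarrow> exp (- b * r) * - b) (at_right 0)"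
      by (rule tendsto_mono[OF at_le, rotated]) simp
    have "((\<lambda>h. ?E h * (b * u r + \<delta>) + u r * ((?E h - exp (- b * r)) / h))
        \<longlongrightarrow> exp (- b * (r + 0)) * (b * u r + \<delta>) + u r * (exp (- b * r) * - b)) (at_right 0)"
      by (intro tendsto_intros dE)
    moreover have "exp (- b * (r + 0)) * (b * u r + \<delta>) + u r * (exp (- b * r) * - b) < \<epsilon>"
      using e by (simp add: \<delta>_def algebra_simps exp_minus)
    ultimately have "\<forall>\<^sub>F h in at_right 0.
        ?E h * (b * u r + \<delta>) + u r * ((?E h - exp (- b * r)) / h) < \<epsilon>"
      by (rule order_tendstoD)
    with slope eventually_at_right_less[of "0::real"]
    show "\<forall>\<^sub>F h in at_right 0. ?v (r + h) \<le> ?v r + \<epsilon> * h"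
    proof eventually_elim
      case (elim h)
      have "?v (r + h) - ?v r = h * (?E h * ((u (r + h) - u r) / h) + u r * ((?E h - exp (- b * r)) / h))"
        using elim by (simp add: field_simps)
      also have "\<dots> \<le> h * (?E h * (b * u r + \<delta>) + u r * ((?E h - exp (- b * r)) / h))"
        using elim by (intro mult_left_mono add_right_mono) auto
      also have "\<dots> \<le> h * \<epsilon>" using elim by (intro mult_left_mono) auto
      finally show ?case by (simp add: mult.commute)
    qed
  qed
  then have le: "exp (b * t) * ?v t \<le> exp (b * t) * ?v s" by (rule mult_left_mono) simp
  have eq: "exp (b * t) * ?v r = exp (b * (t - r)) * u r" for r
  proof -
    have "exp (b * t) * exp (- b * r) = exp (b * (t - r))"
      by (simp only: exp_add[symmetric]) (simp add: algebra_simps)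
    then show ?thesis by (simp only: mult.assoc[symmetric])
  qed
  from le show ?thesis unfolding eq by simp
qed

section \<open>Local existence of solutions at a dense set of times\<close>

text \<open>A uniform Lipschitz constant in the second argument upgrades separate continuity to what Picard
iteration needs: continuity of the integrand.\<close>

lemma continuous_on_along_curve:
  fixes g :: "real \<Rightarrow> 'a::real_normed_vector \<Rightarrow> 'b::real_normed_vector"
  assumes cont: "\<And>u. continuous_on S (\<lambda>t. g t u)"
    and lip: "\<And>t u v. t \<in> S \<Longrightarrow> norm (g t u - g t v) \<le> m * norm (u - v)"
    and \<phi>: "continuous_on S \<phi>"
  shows "continuous_on S (\<lambda>t. g t (\<phi> t))"
  unfolding continuous_on_def
proof
  fix r assume r: "r \<in> S"
  have "((\<lambda>t. m * norm (\<phi> t - \<phi> r) + norm (g t (\<phi> r) - g r (\<phi> r)))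
      \<longlongrightarrow> m * norm (\<phi> r - \<phi> r) + norm (g r (\<phi> r) - g r (\<phi> r))) (at r within S)"
    using r \<phi> cont[of "\<phi> r"] by (intro tendsto_intros) (auto simp: continuous_on_def)
  then have lim: "((\<lambda>t. m * norm (\<phi> t - \<phi> r) + norm (g t (\<phi> r) - g r (\<phi> r))) \<longlongrightarrow> 0) (at r within S)"
    by simp
  have "norm (g t (\<phi> t) - g r (\<phi> r)) \<le> m * norm (\<phi> t - \<phi> r) + norm (g t (\<phi> r) - g r (\<phi> r))"
    if "t \<in> S" for t
    using norm_triangle_ineq[of "g t (\<phi> t) - g t (\<phi> r)" "g t (\<phi> r) - g r (\<phi> r)"]
      lip[OF that, of "\<phi> t" "\<phi> r"] by simp
  then have "((\<lambda>t. g t (\<phi> t) - g r (\<phi> r)) \<longlongrightarrow> 0) (at r within S)"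
    by (intro Lim_null_comparison[OF _ lim]) (auto simp: eventually_at_filter)
  then show "((\<lambda>t. g t (\<phi> t)) \<longlongrightarrow> g r (\<phi> r)) (at r within S)"
    by (simp add: LIM_zero_iff)
qed

text \<open>Banach's fixed point theorem for the Picard operator. Bounded continuous functions on the whole
line form a complete space, so functions on the time interval are represented by their extensions
that are constant outside of it, which is the effect of \<open>clamp\<close>.\<close>

lemma picard_short_time:
  fixes g :: "real \<Rightarrow> 'a::euclidean_space \<Rightarrow> 'a"
  assumes "c \<le> e" "0 \<le> m" and short: "m * (e - c) \<le> 1 / 2"
    and cont: "\<And>u. continuous_on {c..e} (\<lambda>t. g t u)"
    and lip: "\<And>t u v. t \<in> {c..e} \<Longrightarrow> norm (g t u - g t v) \<le> m * norm (u - v)"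
  obtains \<phi> where "\<phi> c = x"
    "\<And>t. t \<in> {c..e} \<Longrightarrow> (\<phi> has_vector_derivative g t (\<phi> t)) (at t within {c..e})"
proof -
  let ?I = "\<lambda>\<phi> t. x + integral {c..t} (\<lambda>s. g s (apply_bcontfun \<phi> s))"
  have g\<phi>: "continuous_on {c..e} (\<lambda>s. g s (apply_bcontfun \<phi> s))" for \<phi>
    by (rule continuous_on_along_curve[OF cont lip]) auto
  have "\<exists>\<psi>. \<forall>t. apply_bcontfun \<psi> t = ?I \<phi> (clamp c e t)" for \<phi>
  proof -
    have "continuous_on (cbox c e) (?I \<phi>)"
      unfolding cbox_interval
      by (intro continuous_intros indefinite_integral_continuous_1 integrable_continuous_real g\<phi>)
    from continuous_on_cbox_bcontfunE[OF this] show ?thesis by metis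
  qed
  then obtain P where P: "\<And>\<phi> t. apply_bcontfun (P \<phi>) t = ?I \<phi> (clamp c e t)"
    by metis
  have clamp: "clamp c e t \<in> {c..e}" for t
    using clamp_in_interval[of c e t] \<open>c \<le> e\<close> by simp
  have contraction: "dist (P \<phi>) (P \<psi>) \<le> 1 / 2 * dist \<phi> \<psi>" for \<phi> \<psi>
  proof (rule dist_bound)
    fix t
    let ?\<tau> = "clamp c e t"
    have sub: "{c..?\<tau>} \<subseteq> {c..e}" using clamp[of t] by auto
    have int: "(\<lambda>s. g s (apply_bcontfun \<phi> s)) integrable_on {c..?\<tau>}" for \<phi>
      by (rule integrable_continuous_real[OF continuous_on_subset[OF g\<phi> sub]])
    have "dist (apply_bcontfun (P \<phi>) t) (apply_bcontfun (P \<psi>) t)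
        = norm (integral {c..?\<tau>} (\<lambda>s. g s (apply_bcontfun \<phi> s) - g s (apply_bcontfun \<psi> s)))"
      by (simp add: P dist_norm integral_diff[OF int int])
    also have "\<dots> \<le> (m * dist \<phi> \<psi>) * (?\<tau> - c)"
    proof (rule integral_bound)
      show "continuous_on {c..?\<tau>} (\<lambda>s. g s (apply_bcontfun \<phi> s) - g s (apply_bcontfun \<psi> s))"
        by (intro continuous_intros continuous_on_subset[OF g\<phi> sub])
      fix s assume "s \<in> {c..?\<tau>}"
      then have "norm (g s (apply_bcontfun \<phi> s) - g s (apply_bcontfun \<psi> s))
          \<le> m * dist (apply_bcontfun \<phi> s) (apply_bcontfun \<psi> s)"
        using lip sub unfolding dist_norm by blast
      also have "\<dots> \<le> m * dist \<phi> \<psi>"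
        by (intro mult_left_mono dist_bounded \<open>0 \<le> m\<close>)
      finally show "norm (g s (apply_bcontfun \<phi> s) - g s (apply_bcontfun \<psi> s)) \<le> m * dist \<phi> \<psi>" .
    qed (use clamp[of t] in auto)
    also have "\<dots> \<le> (m * dist \<phi> \<psi>) * (e - c)"
      using clamp[of t] \<open>0 \<le> m\<close> by (intro mult_left_mono) auto
    also have "\<dots> = (m * (e - c)) * dist \<phi> \<psi>" by simp
    also have "\<dots> \<le> 1 / 2 * dist \<phi> \<psi>" by (intro mult_right_mono short) simp
    finally show "dist (apply_bcontfun (P \<phi>) t) (apply_bcontfun (P \<psi>) t) \<le> 1 / 2 * dist \<phi> \<psi>" .
  qed
  then obtain \<phi> where "P \<phi> = \<phi>"
    using banach_fix_type[of "1 / 2" P] by auto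
  then have fixed: "apply_bcontfun \<phi> t = ?I \<phi> t" if "t \<in> {c..e}" for t
    using P[of \<phi> t] that clamp_cancel_cbox[of t c e] by simp
  show thesis
  proof
    show "apply_bcontfun \<phi> c = x" using fixed[of c] \<open>c \<le> e\<close> by simp
    fix t assume t: "t \<in> {c..e}"
    have "(?I \<phi> has_vector_derivative 0 + g t (apply_bcontfun \<phi> t)) (at t within {c..e})"
      by (intro has_vector_derivative_add has_vector_derivative_const
          integral_has_vector_derivative[OF g\<phi> t])
    then show "(apply_bcontfun \<phi> has_vector_derivative g t (apply_bcontfun \<phi> t)) (at t within {c..e})"
      using has_vector_derivative_transform[OF t fixed] by simp
  qed
qed

lemma solution_restrict:
  assumes "solution f t0 T x \<phi>" "t0 < T'" "T' \<le> T"
  shows "solution f t0 T' x \<phi>"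
  using assms unfolding solution_def
  by (auto intro: has_vector_derivative_within_subset[of _ _ _ "{t0..<T}"])

lemma solution_continuous_on:
  assumes "solution f t0 T x \<phi>"
  shows "continuous_on {t0..<T} \<phi>"
  using assms has_vector_derivative_continuous
  unfolding solution_def continuous_on_eq_continuous_within by blast

text \<open>The field is Lipschitz on a ball only; composing it with the nearest-point projection onto the ball
makes it globally Lipschitz with the same constant. The solution of the modified equation solves
the original one for as long as it stays in the ball.\<close>

lemma local_solution_exists:
  fixes f :: "real \<Rightarrow> real ^ 'n \<Rightarrow> real ^ 'n"
  assumes cd: "c < d" and m: "0 \<le> m" and x: "x \<in> ball 0 R"
    and cont: "\<And>u. continuous_on {c..d} (\<lambda>t. f t u)"
    and lip: "\<And>t u v. t \<in> {c..d} \<Longrightarrow> u \<in> cball 0 R \<Longrightarrow> v \<in> cball 0 R \<Longrightarrow>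
      norm (f t u - f t v) \<le> m * norm (u - v)"
  obtains T \<phi> where "solution f c T x \<phi>"
proof -
  \<comment> \<open>The length makes the Picard operator contract by \<open>1 / 2\<close>; the \<open>+ 1\<close> covers the case \<open>m = 0\<close>.\<close>
  define e where "e = min d (c + 1 / (2 * (m + 1)))"
  have ce: "c < e" "e \<le> d" using cd m by (auto simp: e_def)
  have "m * (e - c) \<le> m * (1 / (2 * (m + 1)))"
    using m by (intro mult_left_mono) (auto simp: e_def)
  also have "\<dots> \<le> 1 / 2" using m by (simp add: field_simps)
  finally have short: "m * (e - c) \<le> 1 / 2" .
  let ?p = "closest_point (cball 0 R) :: real ^ 'n \<Rightarrow> _"
  have R: "cball 0 R \<noteq> ({} :: (real ^ 'n) set)"
    using x mem_ball_imp_mem_cball by blast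
  have p: "?p u \<in> cball 0 R" for u
    by (rule closest_point_in_set[OF closed_cball R])
  have clipped_lip: "norm (f t (?p u) - f t (?p v)) \<le> m * norm (u - v)" if "t \<in> {c..e}" for t u v
  proof -
    have clipped_lip: "norm (f t (?p u) - f t (?p v)) \<le> m * norm (?p u - ?p v)"
      using that ce p by (intro lip) auto
    also have "\<dots> \<le> m * norm (u - v)"
      using closest_point_lipschitz[OF convex_cball closed_cball R, of u v] m
      by (intro mult_left_mono) (auto simp: dist_norm)
    finally show ?thesis .
  qed
  have clipped_cont: "continuous_on {c..e} (\<lambda>t. f t (?p u))" for u
    by (rule continuous_on_subset[OF cont]) (use ce in auto)
  obtain \<phi> where \<phi>: "\<phi> c = x"
    "\<And>t. t \<in> {c..e} \<Longrightarrow> (\<phi> has_vector_derivative f t (?p (\<phi> t))) (at t within {c..e})"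
    by (rule picard_short_time[OF less_imp_le[OF ce(1)] m short clipped_cont clipped_lip]) auto
  have "continuous_on {c..e} \<phi>"
    using \<phi>(2) has_vector_derivative_continuous by (fastforce simp: continuous_on_eq_continuous_within)
  then have "(\<phi> \<longlongrightarrow> x) (at c within {c..e})"
    using \<phi>(1) ce by (auto simp: continuous_on_def)
  then have "\<forall>\<^sub>F t in at c within {c..e}. \<phi> t \<in> ball 0 R"
    using topological_tendstoD[OF _ open_ball x] by blast
  then obtain \<delta> where \<delta>: "0 < \<delta>"
    "\<And>t. t \<in> {c..e} \<Longrightarrow> t \<noteq> c \<Longrightarrow> dist t c < \<delta> \<Longrightarrow> \<phi> t \<in> ball 0 R"
    unfolding eventually_at by blast
  define T where "T = min e (c + \<delta>)"
  have T: "c < T" "T \<le> e" using ce \<delta> by (auto simp: T_def)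
  have "?p (\<phi> t) = \<phi> t" if "t \<in> {c..<T}" for t
  proof (rule closest_point_self)
    show "\<phi> t \<in> cball 0 R"
    proof (cases "t = c")
      case True
      then show ?thesis using \<phi>(1) x by simp
    next
      case False
      then have "\<phi> t \<in> ball 0 R"
        using that by (intro \<delta>(2)) (auto simp: T_def dist_real_def)
      then show ?thesis by simp
    qed
  qed
  moreover have "(\<phi> has_vector_derivative f t (?p (\<phi> t))) (at t within {c..<T})"
    if "t \<in> {c..<T}" for t
    by (rule has_vector_derivative_within_subset[OF \<phi>(2)]) (use that T in auto)
  ultimately have "solution f c T x \<phi>"
    using T \<phi>(1) by (auto simp: solution_def)
  then show thesis by (rule that)
qed

lemma C1_lipschitz_on_compact:
  fixes g :: "real ^ 'n \<Rightarrow> real ^ 'm"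
  assumes deriv: "\<And>z. z \<in> K \<Longrightarrow> (g has_derivative (\<lambda>v. J z *v v)) (at z)"
    and J: "continuous_on K J" and K: "compact K" "convex K"
  shows "\<exists>m. \<forall>u\<in>K. \<forall>v\<in>K. norm (g u - g v) \<le> m * norm (u - v)"
proof -
  obtain B where B: "\<And>z. z \<in> K \<Longrightarrow> norm (J z) \<le> B"
    using compact_imp_bounded[OF compact_continuous_image[OF J K(1)]]
    by (auto simp: bounded_iff)
  have entry: "\<bar>J z $ i $ j\<bar> \<le> B" if "z \<in> K" for z i j
    using B[OF that] component_le_norm_cart[of "J z $ i" j] Finite_Cartesian_Product.norm_nth_le[of "J z" i] by linarith
  show ?thesis
    using differentiable_bound[OF K(2) has_derivative_at_withinI[OF deriv]
        onorm_le_matrix_component[OF entry]]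
    by blast
qed

text \<open>The times at which the constant \<open>m\<close> is valid form a closed set, by continuity in time at fixed
points. These sets cover the interval, so by Baire's theorem one of them contains an interval.\<close>

lemma uniform_lipschitz_on_subinterval:
  fixes f :: "real \<Rightarrow> 'a::real_normed_vector \<Rightarrow> 'b::real_normed_vector"
  assumes ad: "a < d"
    and cont: "\<And>u. u \<in> K \<Longrightarrow> continuous_on {a..d} (\<lambda>t. f t u)"
    and lip: "\<And>t. t \<in> {a..d} \<Longrightarrow> \<exists>m. \<forall>u\<in>K. \<forall>v\<in>K. norm (f t u - f t v) \<le> m * norm (u - v)"
  obtains c e and m :: nat where "a \<le> c" "c < e" "e \<le> d"
    "\<And>t u v. t \<in> {c..e} \<Longrightarrow> u \<in> K \<Longrightarrow> v \<in> K \<Longrightarrow> norm (f t u - f t v) \<le> m * norm (u - v)"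
proof (rule ccontr)
  note found = that
  assume none: "\<not> thesis"
  define F where "F m = {t \<in> {a..d}. \<forall>u\<in>K. \<forall>v\<in>K. norm (f t u - f t v) \<le> real m * norm (u - v)}"
    for m :: nat
  have no_interval: "\<not> {c..e} \<subseteq> F m" if "a \<le> c" "c < e" "e \<le> d" for c e m
  proof
    assume "{c..e} \<subseteq> F m"
    then have "norm (f t u - f t v) \<le> m * norm (u - v)" if "t \<in> {c..e}" "u \<in> K" "v \<in> K" for t u v
      using that by (auto simp: F_def)
    then show False using none found[OF \<open>a \<le> c\<close> \<open>c < e\<close> \<open>e \<le> d\<close>] by blast
  qed
  have closed: "closedin (top_of_set {a..d}) (F m)" for m
  proof -
    have "closedin (top_of_set {a..d})
        ({a..d} \<inter> (\<lambda>t. norm (f t u - f t v) - real m * norm (u - v)) -` {..0})"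
      if "u \<in> K" "v \<in> K" for u v
      using that by (intro continuous_closedin_preimage continuous_intros cont closed_atMost)
    then have "closedin (top_of_set {a..d})
        (\<Inter>u\<in>K. \<Inter>v\<in>K. {a..d} \<inter> (\<lambda>t. norm (f t u - f t v) - real m * norm (u - v)) -` {..0})"
      if "K \<noteq> {}"
      using that by (intro closedin_INT) auto
    moreover have "F m = (if K = {} then {a..d} else (\<Inter>u\<in>K. \<Inter>v\<in>K.
        {a..d} \<inter> (\<lambda>t. norm (f t u - f t v) - real m * norm (u - v)) -` {..0}))"
      by (auto simp: F_def)
    ultimately show ?thesis by (cases "K = {}") (simp_all only: if_True if_False simp_thms closedin_subtopology_refl topspace_euclidean subset_UNIV)
  qed
  have "{a..d} \<subseteq> closure (\<Inter>m. {a..d} - F m)"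
  proof (rule Baire)
    fix G assume "G \<in> range (\<lambda>m. {a..d} - F m)"
    then obtain m where G: "G = {a..d} - F m" by blast
    have "{a..d} \<subseteq> closure G"
    proof
      fix t assume t: "t \<in> {a..d}"
      show "t \<in> closure G"
        unfolding closure_approachable
      proof (intro allI impI)
        fix \<epsilon> :: real assume e: "0 < \<epsilon>"
        have "\<not> {max a (t - \<epsilon> / 2)..min d (t + \<epsilon> / 2)} \<subseteq> F m"
          using t e ad by (intro no_interval) auto
        then obtain r where r: "r \<in> {max a (t - \<epsilon> / 2)..min d (t + \<epsilon> / 2)}" "r \<notin> F m" by blast
        then have "r \<in> G" "dist r t < \<epsilon>"
          using e by (auto simp: G dist_real_def)
        then show "\<exists>y\<in>G. dist y t < \<epsilon>" by blast
      qed
    qed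
    moreover have "openin (top_of_set {a..d}) G"
      using openin_diff[OF openin_subtopology_self closed[of m]] by (simp add: G)
    ultimately show "openin (top_of_set {a..d}) G \<and> {a..d} \<subseteq> closure G" by blast
  qed auto
  moreover have "(\<Inter>m. {a..d} - F m) = {}"
  proof -
    have "\<exists>m. t \<in> F m" if t: "t \<in> {a..d}" for t
    proof -
      obtain l where l: "\<forall>u\<in>K. \<forall>v\<in>K. norm (f t u - f t v) \<le> l * norm (u - v)"
        using lip[OF t] by blast
      obtain m :: nat where "l \<le> real m" using real_arch_simple by blast
      then have "l * norm (u - v) \<le> real m * norm (u - v)" for u v :: 'a
        by (intro mult_right_mono) auto
      then show ?thesis using l t unfolding F_def by (blast intro: order_trans)
    qed
    then show ?thesis by blast
  qed
  ultimately have "{a..d} \<subseteq> {}" by (simp only: closure_empty)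
  then show False using ad by simp
qed

text \<open>The interval between \<open>t\<close> and \<open>t'\<close> contains a subinterval on which the field has a uniform Lipschitz
constant on a ball around both points; its left end serves as the initial time. Both
solutions are taken on the same time interval, as the exponential bound compares such solutions.\<close>

lemma solutions_start_at_nearby_time:
  fixes f :: "real \<Rightarrow> real ^ 'n \<Rightarrow> real ^ 'n"
  assumes deriv: "\<And>t z. 0 \<le> t \<Longrightarrow> (f t has_derivative (\<lambda>v. J t z *v v)) (at z)"
    and J: "\<And>t. 0 \<le> t \<Longrightarrow> continuous_on UNIV (J t)"
    and cont: "\<And>u. continuous_on {0..} (\<lambda>t. f t u)"
    and t: "0 \<le> t" "t < t'"
  obtains s T \<phi> \<psi> where "s \<in> {t..t'}" "solution f s T x \<phi>" "solution f s T y \<psi>"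
proof -
  define R where "R = norm x + norm y + 1"
  have xy: "x \<in> ball 0 R" "y \<in> ball 0 R"
    by (auto simp: R_def intro: add_pos_nonneg add_nonneg_pos)
  have lip: "\<exists>m. \<forall>u\<in>cball 0 R. \<forall>v\<in>cball 0 R. norm (f s u - f s v) \<le> m * norm (u - v)"
    if "s \<in> {t..t'}" for s
    using that t
    by (intro C1_lipschitz_on_compact[where J = "J s"] deriv
        continuous_on_subset[OF J subset_UNIV] compact_cball convex_cball) auto
  have cont': "continuous_on {c..e} (\<lambda>t. f t u)" if "0 \<le> c" for c e u
    using that by (intro continuous_on_subset[OF cont]) auto
  obtain s e and m :: nat where se: "t \<le> s" "s < e" "e \<le> t'"
    "\<And>r u v. r \<in> {s..e} \<Longrightarrow> u \<in> cball 0 R \<Longrightarrow> v \<in> cball 0 R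
      \<Longrightarrow> norm (f r u - f r v) \<le> m * norm (u - v)"
    using uniform_lipschitz_on_subinterval[OF t(2) cont'[OF t(1)] lip] by metis
  have s0: "0 \<le> s" using se t by simp
  obtain T1 \<phi> where \<phi>: "solution f s T1 x \<phi>"
    by (rule local_solution_exists[OF se(2) _ xy(1) cont'[OF s0] se(4)]) auto
  obtain T2 \<psi> where \<psi>: "solution f s T2 y \<psi>"
    by (rule local_solution_exists[OF se(2) _ xy(2) cont'[OF s0] se(4)]) auto
  have "s < min T1 T2" using \<phi> \<psi> by (simp add: solution_def)
  then have "solution f s (min T1 T2) x \<phi>" "solution f s (min T1 T2) y \<psi>"
    using solution_restrict[OF \<phi>] solution_restrict[OF \<psi>] by auto
  then show thesis using that[of s] se by auto
qed

section \<open>Equivalence of the contraction conditions\<close>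

text \<open>The distance of the two solutions and its exponential bound agree at the initial time, so their
right derivatives there are ordered in the same way. Deimling's inequality passes from the
derivative of the norm to the pairing.\<close>

lemma pairing_le_of_exp_bound:
  assumes N: "is_norm N" and W: "deimling N W"
    and \<phi>: "solution f t0 T x \<phi>" and \<psi>: "solution f t0 T y \<psi>"
    and bound: "\<And>t. t0 \<le> t \<Longrightarrow> t < T \<Longrightarrow> N (\<phi> t - \<psi> t) \<le> exp (b * (t - t0)) * N (x - y)"
  shows "W (f t0 x - f t0 y) (x - y) \<le> b * (N (x - y))\<^sup>2"
proof -
  let ?w = "\<lambda>t. \<phi> t - \<psi> t"
  have T: "t0 < T" and w0: "?w t0 = x - y"
    using \<phi> \<psi> by (auto simp: solution_def)
  have "(?w has_vector_derivative (f t0 x - f t0 y)) (at t0 within {t0..<T})"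
    using \<phi> \<psi> T by (auto simp: solution_def intro!: has_vector_derivative_diff)
  from norm_along_curve_tendsto[OF N _ this] T
  have lim: "((\<lambda>h. (N (?w (t0 + h)) - N (x - y)) / h)
      \<longlongrightarrow> norm_right_deriv N (x - y) (f t0 x - f t0 y)) (at_right 0)"
    by (simp add: w0)
  have "((\<lambda>h. exp (b * h)) has_real_derivative b) (at 0)"
    by (auto intro!: derivative_eq_intros)
  then have "((\<lambda>h. (exp (b * h) - 1) / h) \<longlongrightarrow> b) (at 0)"
    by (simp add: DERIV_def)
  then have "((\<lambda>h. (exp (b * h) - 1) / h) \<longlongrightarrow> b) (at_right 0)"
    by (rule tendsto_mono[OF at_le, rotated]) simp
  then have lim': "((\<lambda>h. (exp (b * h) - 1) / h * N (x - y)) \<longlongrightarrow> b * N (x - y)) (at_right 0)"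
    by (intro tendsto_intros)
  have "(N (?w (t0 + h)) - N (x - y)) / h \<le> (exp (b * h) - 1) / h * N (x - y)"
    if "0 < h" "h < T - t0" for h
    using bound[of "t0 + h"] that by (simp add: field_simps)
  then have "\<forall>\<^sub>F h in at_right 0.
      (N (?w (t0 + h)) - N (x - y)) / h \<le> (exp (b * h) - 1) / h * N (x - y)"
    using T by (auto simp: eventually_at_right_field intro!: exI[of _ "T - t0"])
  from tendsto_le[OF trivial_limit_at_right_real lim' lim this]
  have "N (x - y) * norm_right_deriv N (x - y) (f t0 x - f t0 y) \<le> N (x - y) * (b * N (x - y))"
    using is_norm_nonneg[OF N] by (rule mult_left_mono)
  then show ?thesis
    using pairing_le_right_deriv[OF W, of "f t0 x - f t0 y" "x - y"]
    by (simp add: power2_eq_square algebra_simps)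
qed

theorem theorem29:
  fixes f :: "real \<Rightarrow> real ^ 'n \<Rightarrow> real ^ 'n"
    and C :: "(real ^ 'n) set"
    and N :: "real ^ 'n \<Rightarrow> real"
    and W :: "real ^ 'n \<Rightarrow> real ^ 'n \<Rightarrow> real"
    and b :: real
  assumes f_diff: "\<And>t x. 0 \<le> t \<Longrightarrow> f t differentiable (at x)"
    and f_C1: "\<And>t. 0 \<le> t \<Longrightarrow> continuous_on UNIV (\<lambda>x. jacobian (f t) (at x))"
    and f_cont: "\<And>x. continuous_on {0..} (\<lambda>t. f t x)"
    and C: "open C" "convex C" "forward_invariant f C"
    and N: "is_norm N"
    and W: "weak_pairing W" "compatible_pairing N W" "deimling N W"
  shows "all_equivalent
    [\<forall>t\<ge>0. osL N W C (f t) \<le> ereal b,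
     \<forall>t\<ge>0. \<forall>x\<in>C. \<forall>v. W (jacobian (f t) (at x) *v v) v \<le> b * (N v)\<^sup>2,
     \<forall>t\<ge>0. \<forall>x\<in>C. log_norm N (jacobian (f t) (at x)) \<le> b,
     \<forall>x0\<in>C. \<forall>y0\<in>C. \<forall>t0\<ge>0. \<forall>T \<phi> \<psi>.
       solution f t0 T x0 \<phi> \<and> solution f t0 T y0 \<psi> \<longrightarrow>
       (\<forall>t\<in>{t0..<T}. upper_right_dini (\<lambda>s. N (\<phi> s - \<psi> s)) t \<le> ereal (b * N (\<phi> t - \<psi> t))),
     \<forall>x0\<in>C. \<forall>y0\<in>C. \<forall>t0\<ge>0. \<forall>T \<phi> \<psi>.
       solution f t0 T x0 \<phi> \<and> solution f t0 T y0 \<psi> \<longrightarrow>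
       (\<forall>s t. t0 \<le> s \<and> s \<le> t \<and> t < T \<longrightarrow>
          N (\<phi> t - \<psi> t) \<le> exp (b * (t - s)) * N (\<phi> s - \<psi> s))]"
    (is "all_equivalent [?one_sided, ?pairing, ?log_norm, ?dini, ?exponential]")
proof -
  let ?J = "\<lambda>t x. jacobian (f t) (at x)"
  have deriv: "(f t has_derivative (\<lambda>v. ?J t x *v v)) (at x)" if "0 \<le> t" for t x
    using f_diff[OF that] jacobian_works by blast
  have one_sided_iff: "?one_sided \<longleftrightarrow> (\<forall>t\<ge>0. \<forall>x\<in>C. \<forall>y\<in>C. x \<noteq> y \<longrightarrow>
      W (f t x - f t y) (x - y) \<le> b * (N (x - y))\<^sup>2)"
    by (simp add: osL_le_iff[OF N])
  have "?pairing" if "?one_sided"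
  proof (intro allI ballI impI)
    fix t :: real and x v assume "0 \<le> t" "x \<in> C"
    then show "W (?J t x *v v) v \<le> b * (N v)\<^sup>2"
      using that unfolding one_sided_iff
      by (intro pairing_derivative_le[OF W(1) N C(1) _ deriv]) auto
  qed
  moreover have "?log_norm" if "?pairing"
    using that log_norm_le_of_pairing[OF N W(1,2)] by blast
  moreover have "?dini" if log_norm: "?log_norm"
  proof (intro allI ballI impI, elim conjE)
    fix x0 y0 t0 T \<phi> \<psi> t
    assume x0: "x0 \<in> C" and y0: "y0 \<in> C" and t0: "0 \<le> t0"
      and \<phi>: "solution f t0 T x0 \<phi>" and \<psi>: "solution f t0 T y0 \<psi>" and t: "t \<in> {t0..<T}"
    have in_C: "\<phi> t \<in> C" "\<psi> t \<in> C"
      using C(3) x0 y0 t0 \<phi> \<psi> t unfolding forward_invariant_def by blast+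
    have "((\<lambda>s. \<phi> s - \<psi> s) has_vector_derivative f t (\<phi> t) - f t (\<psi> t)) (at t within {t0..<T})"
      using \<phi> \<psi> t by (auto simp: solution_def intro!: has_vector_derivative_diff)
    from tendsto_ereal[OF norm_along_curve_tendsto[OF N t this]]
    have "upper_right_dini (\<lambda>s. N (\<phi> s - \<psi> s)) t
        = ereal (norm_right_deriv N (\<phi> t - \<psi> t) (f t (\<phi> t) - f t (\<psi> t)))"
      unfolding upper_right_dini_def by (rule lim_imp_Limsup[OF trivial_limit_at_right_real])
    also have "\<dots> \<le> ereal (b * N (\<phi> t - \<psi> t))"
      using norm_right_deriv_difference_le[OF N C(2) in_C deriv] log_norm t t0 by simp
    finally show "upper_right_dini (\<lambda>s. N (\<phi> s - \<psi> s)) t \<le> ereal (b * N (\<phi> t - \<psi> t))" .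
  qed
  moreover have "?exponential" if dini: "?dini"
  proof (intro allI ballI impI, elim conjE)
    fix x0 y0 t0 T \<phi> \<psi> s t
    assume x0: "x0 \<in> C" and y0: "y0 \<in> C" and t0: "0 \<le> t0"
      and \<phi>: "solution f t0 T x0 \<phi>" and \<psi>: "solution f t0 T y0 \<psi>"
      and st: "t0 \<le> s" "s \<le> t" "t < T"
    have "continuous_on {t0..<T} (\<lambda>r. \<phi> r - \<psi> r)"
      by (intro continuous_on_diff solution_continuous_on[OF \<phi>] solution_continuous_on[OF \<psi>])
    then have "continuous_on {s..t} (\<lambda>r. \<phi> r - \<psi> r)"
      by (rule continuous_on_subset) (use st in auto)
    then have "continuous_on {s..t} (\<lambda>r. N (\<phi> r - \<psi> r))"
      by (rule continuous_on_compose2[OF is_norm_continuous[OF N]]) simp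
    then show "N (\<phi> t - \<psi> t) \<le> exp (b * (t - s)) * N (\<phi> s - \<psi> s)"
      using dini x0 y0 t0 \<phi> \<psi> st by (intro exp_bound_of_dini) auto
  qed
  moreover have "?one_sided" if exponential: "?exponential"
    unfolding one_sided_iff
  proof (intro allI ballI impI)
    fix t :: real and x y assume t: "0 \<le> t" and xy: "x \<in> C" "y \<in> C"
    let ?w = "\<lambda>s. W (f s x - f s y) (x - y)"
    have at_start: "?w s \<le> b * (N (x - y))\<^sup>2"
      if s: "0 \<le> s" and \<phi>: "solution f s T x \<phi>" and \<psi>: "solution f s T y \<psi>" for s T \<phi> \<psi>
    proof (rule pairing_le_of_exp_bound[OF N W(3) \<phi> \<psi>])
      fix r assume "s \<le> r" "r < T"
      then have "N (\<phi> r - \<psi> r) \<le> exp (b * (r - s)) * N (\<phi> s - \<psi> s)"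
        using exponential xy s \<phi> \<psi> by blast
      then show "N (\<phi> r - \<psi> r) \<le> exp (b * (r - s)) * N (x - y)"
        using \<phi> \<psi> by (simp add: solution_def)
    qed
    have W_cont: "continuous_on UNIV (\<lambda>u. W u (x - y))"
      using W(1) by (simp add: weak_pairing_def)
    have "continuous_on {0..} ?w"
      by (rule continuous_on_compose2[OF W_cont continuous_on_diff[OF f_cont f_cont]]) simp
    then have lim: "(?w \<longlongrightarrow> ?w t) (at t within {0..})"
      using t by (simp add: continuous_on_def)
    show "?w t \<le> b * (N (x - y))\<^sup>2"
    proof (rule ccontr)
      assume "\<not> ?thesis"
      then have gt: "b * (N (x - y))\<^sup>2 < ?w t" by simp
      obtain \<delta> where \<delta>: "0 < \<delta>" "\<And>s. 0 \<le> s \<Longrightarrow> s \<noteq> t \<Longrightarrow> dist s t < \<delta> \<Longrightarrow> b * (N (x - y))\<^sup>2 < ?w s"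
        using order_tendstoD(1)[OF lim gt] unfolding eventually_at by auto
      obtain s T \<phi> \<psi> where s: "s \<in> {t..t + \<delta> / 2}"
        and sol: "solution f s T x \<phi>" "solution f s T y \<psi>"
        by (rule solutions_start_at_nearby_time[OF deriv f_C1 f_cont t, of "t + \<delta> / 2" x y])
          (use \<delta>(1) in auto)
      \<comment> \<open>A violation at \<open>t\<close> would persist up to the time \<open>s\<close>, where it contradicts the estimate.\<close>
      have "b * (N (x - y))\<^sup>2 < ?w s"
        using s \<delta> t gt by (cases "s = t") (auto simp: dist_real_def)
      moreover have "?w s \<le> b * (N (x - y))\<^sup>2"
        using at_start sol s t by auto
      ultimately show False by simp
    qed
  qed
  ultimately show ?thesis
    unfolding all_equivalent_def list.set ball_simps by argo
qed

end
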